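(* Let $V$ be a real inner product space of finite dimension $n\ge 1$, and let $T$ be a symmetric, nondegenerate tensor of order $k\ge 1$ on $V$. Then $T$ has at least one (unit) eigenvector of index $n-1$.
   Context: The norm on $V$ is the one induced by the inner product, and $S^{n-1}=\{v\in V:\|v\|=1\}$. A symmetric order-$k$ tensor $T$ on $V$ is an element of $\operatorname{Sym}^k(V^\vee)$, where $V^\vee$ is the dual of $V$; it corresponds to the homogeneous polynomial of degree $k$, $f(v)=f_T(v,\ldots,v)$, where $f_T\colon V^k\to\mathbb{R}$ is the associated symmetric $k$-linear form. The unit eigenvectors of $T$ are the critical points of the restriction $f|_{S^{n-1}}\colon S^{n-1}\to\mathbb{R}$. An eigenvector is nondegenerate if it is a nondegenerate critical point of $f|_{S^{n-1}}$, i.e. the Hessian of $f|_{S^{n-1}}$ in local coordinates on $S^{n-1}$ is nonsingular there; its index is then its (Morse) index as a nondegenerate critical point, i.e. the number of negative eigenvalues of that Hessian counted with multiplicity. The tensor $T$ is nondegenerate if all its unit eigenvectors are nondegenerate. *)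

theory Defs
  imports
    "HOL-Analysis.Analysis"
    "HOL-Combinatorics.Permutations"
    "Jordan_Normal_Form.Char_Poly"
begin

text \<open>
  A symmetric tensor of order k is given by its symmetric k-linear form. The k arguments are the
  first k entries of a sequence; the first conjunct says that the later entries are irrelevant.
\<close>

definition symmetric_tensor :: "nat \<Rightarrow> ((nat \<Rightarrow> 'a::real_vector) \<Rightarrow> real) \<Rightarrow> bool" where
  "symmetric_tensor k T \<longleftrightarrow>
     (\<forall>v w. (\<forall>i<k. v i = w i) \<longrightarrow> T v = T w) \<and>
     (\<forall>v. \<forall>i<k. linear (\<lambda>x. T (v(i := x)))) \<and>
     (\<forall>v p. p permutes {..<k} \<longrightarrow> T (v \<circ> p) = T v)"

definition tensor_poly :: "((nat \<Rightarrow> 'a::real_vector) \<Rightarrow> real) \<Rightarrow> 'a \<Rightarrow> real" where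
  "tensor_poly T v = T (\<lambda>_. v)"

text \<open>
  Coordinate spaces are \<^term>\<open>Euclidean_space m\<close>, i.e. the sequences \<open>x\<close> with \<open>x i = 0\<close> for
  all \<open>i \<ge> m\<close> (this also covers \<open>m = 0\<close>, needed for the sphere of a line).
  A map is of class C^r on an open set iff all its iterated partial derivatives of order
  at most r exist and are continuous.
\<close>

definition partial_deriv ::
    "nat \<Rightarrow> ((nat \<Rightarrow> real) \<Rightarrow> 'b::real_normed_vector) \<Rightarrow> (nat \<Rightarrow> real) \<Rightarrow> 'b" where
  "partial_deriv i g x = vector_derivative (\<lambda>t. g (x(i := t))) (at (x i))"

primrec Cr_on ::
    "nat \<Rightarrow> nat \<Rightarrow> (nat \<Rightarrow> real) set \<Rightarrow> ((nat \<Rightarrow> real) \<Rightarrow> 'b::real_normed_vector) \<Rightarrow> bool" where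
  "Cr_on 0 m U g \<longleftrightarrow> continuous_on U g"
| "Cr_on (Suc r) m U g \<longleftrightarrow> continuous_on U g \<and>
     (\<forall>i<m. (\<forall>x\<in>U. (\<lambda>t. g (x(i := t))) differentiable (at (x i))) \<and>
            Cr_on r m U (partial_deriv i g))"

definition smooth_on_coords ::
    "nat \<Rightarrow> (nat \<Rightarrow> real) set \<Rightarrow> ((nat \<Rightarrow> real) \<Rightarrow> 'b::real_normed_vector) \<Rightarrow> bool" where
  "smooth_on_coords m U g \<longleftrightarrow> (\<forall>r. Cr_on r m U g)"

text \<open>
  Local coordinates on the unit sphere, given by the inverse of the chart: a smooth
  immersion of an open set of the (n-1)-dimensional coordinate space that is a homeomorphism
  onto an open subset of the sphere.
\<close>

definition sphere_param :: "(nat \<Rightarrow> real) set \<Rightarrow> ((nat \<Rightarrow> real) \<Rightarrow> 'a::euclidean_space) \<Rightarrow> bool" where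
  "sphere_param U \<phi> \<longleftrightarrow>
     openin (Euclidean_space (DIM('a) - 1)) U \<and>
     smooth_on_coords (DIM('a) - 1) U \<phi> \<and>
     (\<forall>x\<in>U. \<forall>c. (\<Sum>i<DIM('a) - 1. c i *\<^sub>R partial_deriv i \<phi> x) = 0 \<longrightarrow>
                (\<forall>i<DIM('a) - 1. c i = 0)) \<and>
     openin (top_of_set (sphere 0 1)) (\<phi> ` U) \<and>
     (\<exists>\<psi>. homeomorphism U (\<phi> ` U) \<phi> \<psi>)"

definition hessian_mat :: "nat \<Rightarrow> ((nat \<Rightarrow> real) \<Rightarrow> real) \<Rightarrow> (nat \<Rightarrow> real) \<Rightarrow> real mat" where
  "hessian_mat m g x = mat m m (\<lambda>(i, j). partial_deriv i (partial_deriv j g) x)"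

definition num_neg_eigenvalues :: "real mat \<Rightarrow> nat" where
  "num_neg_eigenvalues A = (\<Sum>a | eigenvalue A a \<and> a < 0. order a (char_poly A))"

text \<open>
  Notions for the restriction of \<open>f\<close> to the unit sphere at \<open>v\<close>. Criticality, nondegeneracy and
  index do not depend on the local coordinates around \<open>v\<close>; they are required in all of them.
\<close>

definition sphere_critical_point :: "('a::euclidean_space \<Rightarrow> real) \<Rightarrow> 'a \<Rightarrow> bool" where
  "sphere_critical_point f v \<longleftrightarrow> v \<in> sphere 0 1 \<and>
     (\<forall>U \<phi> x. sphere_param U \<phi> \<and> x \<in> U \<and> \<phi> x = v \<longrightarrow>
        (\<forall>i<DIM('a) - 1. partial_deriv i (f \<circ> \<phi>) x = 0))"

definition sphere_nondegenerate_critical_point ::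
    "('a::euclidean_space \<Rightarrow> real) \<Rightarrow> 'a \<Rightarrow> bool" where
  "sphere_nondegenerate_critical_point f v \<longleftrightarrow> sphere_critical_point f v \<and>
     (\<forall>U \<phi> x. sphere_param U \<phi> \<and> x \<in> U \<and> \<phi> x = v \<longrightarrow>
        invertible_mat (hessian_mat (DIM('a) - 1) (f \<circ> \<phi>) x))"

definition sphere_has_morse_index :: "('a::euclidean_space \<Rightarrow> real) \<Rightarrow> 'a \<Rightarrow> nat \<Rightarrow> bool" where
  "sphere_has_morse_index f v p \<longleftrightarrow> sphere_nondegenerate_critical_point f v \<and>
     (\<forall>U \<phi> x. sphere_param U \<phi> \<and> x \<in> U \<and> \<phi> x = v \<longrightarrow>
        num_neg_eigenvalues (hessian_mat (DIM('a) - 1) (f \<circ> \<phi>) x) = p)"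

definition unit_eigenvector :: "((nat \<Rightarrow> 'a::euclidean_space) \<Rightarrow> real) \<Rightarrow> 'a \<Rightarrow> bool" where
  "unit_eigenvector T v \<longleftrightarrow> sphere_critical_point (tensor_poly T) v"

definition nondegenerate_tensor :: "((nat \<Rightarrow> 'a::euclidean_space) \<Rightarrow> real) \<Rightarrow> bool" where
  "nondegenerate_tensor T \<longleftrightarrow>
     (\<forall>v. unit_eigenvector T v \<longrightarrow> sphere_nondegenerate_critical_point (tensor_poly T) v)"

end

theory Submission
  imports Defs
begin

text \<open>
  A maximum \<open>v\<close> of the polynomial on the compact sphere is critical, and in every chart its
  Hessian is symmetric and negative semidefinite. Nondegeneracy makes the Hessian invertible, hence
  negative definite, and since its characteristic polynomial splits over the reals, its negative
  eigenvalues account for the full multiplicity \<open>n - 1\<close>.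
\<close>

section \<open>Spectra of real symmetric matrices and the count of negative eigenvalues\<close>

text \<open>Symmetry moves the matrix across the product of \<open>v\<close> with
  \<open>conjugate v\<close>, and real entries make \<open>conjugate v\<close> an eigenvector for
  \<open>cnj z\<close>. The two values of the product differ only by the factors \<open>z\<close>
  and \<open>cnj z\<close>, and the product of \<open>v\<close> with its conjugate is
  nonzero.\<close>

lemma real_symmetric_mat_eigenvalue_real:
  fixes A :: "real mat"
  assumes A: "A \<in> carrier_mat n n" and sym: "transpose_mat A = A"
    and ev: "eigenvalue (map_mat complex_of_real A) z"
  shows "z \<in> \<real>"
proof -
  let ?C = "map_mat complex_of_real A"
  have C: "?C \<in> carrier_mat n n" using A by simp
  have symC: "transpose_mat ?C = ?C"
    by (simp add: map_mat_transpose sym)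
  from ev C obtain v where v: "v \<in> carrier_vec n" "v \<noteq> 0\<^sub>v n" "?C *\<^sub>v v = z \<cdot>\<^sub>v v"
    unfolding eigenvalue_def eigenvector_def by auto
  have cv: "conjugate v \<in> carrier_vec n" using v(1) by simp
  have "?C *\<^sub>v conjugate v = conjugate (?C *\<^sub>v v)"
    using A v(1) by (intro eq_vecI) (auto simp: scalar_prod_def cnj_sum conjugate_complex_def)
  also have "\<dots> = cnj z \<cdot>\<^sub>v conjugate v"
    using v by (simp add: conjugate_smult_vec conjugate_complex_def)
  finally have conj: "?C *\<^sub>v conjugate v = cnj z \<cdot>\<^sub>v conjugate v" .
  have "z * scalar_prod v (conjugate v) = scalar_prod (?C *\<^sub>v v) (conjugate v)"
    using v cv by simp
  also have "\<dots> = scalar_prod v (?C *\<^sub>v conjugate v)"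
    using transpose_vec_mult_scalar[OF C cv v(1)] by (simp add: symC)
  also have "\<dots> = cnj z * scalar_prod v (conjugate v)"
    using v cv by (simp add: conj)
  finally have "z = cnj z"
    using v by simp
  then show ?thesis
    by (metis Reals_cnj_iff)
qed

text \<open>Over the complex numbers the characteristic polynomial splits. Its roots are
  eigenvalues, hence real, so the factorization descends to the reals.\<close>

lemma real_symmetric_mat_char_poly_splits:
  fixes A :: "real mat"
  assumes A: "A \<in> carrier_mat n n" and sym: "transpose_mat A = A"
  obtains rs where "char_poly A = (\<Prod>r\<leftarrow>rs. [:- r, 1:])" "length rs = n"
proof -
  let ?C = "map_mat complex_of_real A"
  have C: "?C \<in> carrier_mat n n" using A by simp
  obtain zs where zs: "char_poly ?C = (\<Prod>z\<leftarrow>zs. [:- z, 1:])" "length zs = n"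
    using char_poly_factorized[OF C] by blast
  have "eigenvalue ?C z" if "z \<in> set zs" for z
    using that unfolding eigenvalue_root_char_poly[OF C] zs(1)
    by (induction zs) auto
  then have real: "complex_of_real (Re z) = z" if "z \<in> set zs" for z
    using real_symmetric_mat_eigenvalue_real[OF A sym] that by (simp add: of_real_Re)
  \<comment> \<open>Stated for any list of known roots, so that the induction on the list keeps the
    realness of each entry available.\<close>
  have prod: "map_poly complex_of_real (\<Prod>r\<leftarrow>map Re zs'. [:- r, 1:]) = (\<Prod>z\<leftarrow>zs'. [:- z, 1:])"
    if "set zs' \<subseteq> set zs" for zs'
    using that
  proof (induction zs')
    case (Cons z zs')
    interpret map_poly_comm_ring_hom complex_of_real ..
    have "map_poly complex_of_real [:- Re z, 1:] = [:- z, 1:]"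
      using real[of z] Cons.prems by simp
    then show ?case using Cons by (simp add: hom_mult o_def del: mult_pCons_left)
  qed simp
  have "char_poly ?C = map_poly complex_of_real (char_poly A)"
    by (rule of_real_hom.char_poly_hom[OF A])
  then have "map_poly complex_of_real (char_poly A) = map_poly complex_of_real (\<Prod>r\<leftarrow>map Re zs. [:- r, 1:])"
    using prod[of zs] zs(1) by simp
  then have "char_poly A = (\<Prod>r\<leftarrow>map Re zs. [:- r, 1:])"
    by (simp add: poly_eq_iff coeff_map_poly)
  then show ?thesis using that zs(2) by (metis length_map)
qed

lemma order_prod_list_linear:
  fixes rs :: "'a::field list"
  shows "order a (\<Prod>r\<leftarrow>rs. [:- r, 1:]) = count_list rs a"
proof (induction rs)
  case (Cons r rs)
  have "(\<Prod>r\<leftarrow>r # rs. [:- r, 1:]) \<noteq> 0"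
    by (simp only: prod_list_zero_iff) auto
  then show ?case using Cons
    by (simp add: order_mult order_linear' del: mult_pCons_left)
qed simp

text \<open>Semidefiniteness bounds every eigenvalue by 0 and invertibility excludes 0. All
  \<open>n\<close> real roots of the characteristic polynomial are thus negative, and their
  multiplicities add up to \<open>n\<close>.\<close>

lemma num_neg_eigenvalues_negative_definite:
  assumes A: "A \<in> carrier_mat n n" and sym: "transpose_mat A = A" and inv: "invertible_mat A"
    and le: "\<And>v. v \<in> carrier_vec n \<Longrightarrow> scalar_prod v (A *\<^sub>v v) \<le> 0"
  shows "num_neg_eigenvalues A = n"
proof -
  have neg: "a < 0" if ev: "eigenvalue A a" for a
  proof -
    from ev A obtain v where v: "v \<in> carrier_vec n" "v \<noteq> 0\<^sub>v n" "A *\<^sub>v v = a \<cdot>\<^sub>v v"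
      unfolding eigenvalue_def eigenvector_def by auto
    have pos: "scalar_prod v v > 0"
      using conjugate_square_greater_0_vec[OF v(1)] v(2) by simp
    have "a * scalar_prod v v \<le> 0" using le[OF v(1)] v by simp
    with pos have "a \<le> 0" by (simp add: mult_le_0_iff)
    moreover have "a \<noteq> 0"
    proof
      assume "a = 0"
      with v have Av: "A *\<^sub>v v = 0\<^sub>v n" by auto
      obtain B where B: "B * A = 1\<^sub>m (dim_row B)" and B': "A * B = 1\<^sub>m (dim_row A)"
        using inv unfolding invertible_mat_def inverts_mat_def by auto
      \<comment> \<open>\<open>invertible_mat\<close> does not state the shape of the inverse;
        comparing the column counts in the two identities yields it.\<close>
      have "dim_row B = n"
        using arg_cong[OF B, of dim_col] A by simp
      moreover have "dim_col B = n"
        using arg_cong[OF B', of dim_col] A by simp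
      ultimately have dims: "B \<in> carrier_mat n n"
        by auto
      have "v = (B * A) *\<^sub>v v" using B dims v(1) by simp
      also have "\<dots> = B *\<^sub>v (A *\<^sub>v v)" using dims A v(1) by simp
      also have "\<dots> = 0\<^sub>v n" using dims Av by auto
      finally show False using v(2) by simp
    qed
    ultimately show ?thesis by simp
  qed
  obtain rs where rs: "char_poly A = (\<Prod>r\<leftarrow>rs. [:- r, 1:])" "length rs = n"
    using real_symmetric_mat_char_poly_splits[OF A sym] by blast
  have "eigenvalue A a \<longleftrightarrow> a \<in> set rs" for a
    unfolding eigenvalue_root_char_poly[OF A] rs(1) by (induction rs) auto
  with neg have "{a. eigenvalue A a \<and> a < 0} = set rs" by auto
  then show ?thesis
    unfolding num_neg_eigenvalues_def rs(1) order_prod_list_linear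
    using rs(2) sum_count_set[of rs "set rs"] by simp
qed

section \<open>Open sets of the coordinate spaces\<close>

lemma Euclidean_space_eq_top_of_set: "Euclidean_space m = top_of_set {x. \<forall>i\<ge>m. x i = 0}"
  by (simp add: Euclidean_space_def euclidean_product_topology)

lemma openin_Euclidean_space_imp_zero:
  assumes "openin (Euclidean_space m) U" "x \<in> U" "i \<ge> m"
  shows "x i = 0"
  using openin_subset[OF assms(1)] assms(2,3) by (auto simp: topspace_Euclidean_space)

text \<open>A basic open set of the product topology restricts only finitely many coordinates, so
  one radius serves them all.\<close>

lemma openin_Euclidean_space_box:
  assumes "openin (Euclidean_space m) U" "x \<in> U"
  obtains e where "e > 0"
    "\<And>y. \<lbrakk>\<And>i. \<bar>y i - x i\<bar> < e; \<And>i. i \<ge> m \<Longrightarrow> y i = 0\<rbrakk> \<Longrightarrow> y \<in> U"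
proof -
  obtain W where W: "open W" "U = W \<inter> {x. \<forall>i\<ge>m. x i = 0}"
    using assms(1) by (auto simp: Euclidean_space_eq_top_of_set openin_open)
  then have "openin (product_topology (\<lambda>i. euclidean) UNIV) W" "x \<in> W"
    using assms(2) by (auto simp: euclidean_product_topology)
  from product_topology_open_contains_basis[OF this]
  obtain X where X: "x \<in> (\<Pi>\<^sub>E i\<in>UNIV. X i)" "\<And>i. open (X i)" "finite {i. X i \<noteq> UNIV}"
    "(\<Pi>\<^sub>E i\<in>UNIV. X i) \<subseteq> W"
    by auto
  have "\<exists>d>0. \<forall>t. \<bar>t - x i\<bar> < d \<longrightarrow> t \<in> X i" for i
    using X(1) X(2)[of i] by (force simp: open_dist dist_real_def)
  then obtain d where d: "\<And>i. d i > 0" "\<And>i t. \<bar>t - x i\<bar> < d i \<Longrightarrow> t \<in> X i"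
    by metis
  \<comment> \<open>Inserting 1 keeps the minimum defined when no coordinate is restricted.\<close>
  define e where "e = Min (insert 1 (d ` {i. X i \<noteq> UNIV}))"
  show thesis
  proof
    show "e > 0" using X(3) d(1) by (auto simp: e_def)
    fix y assume y: "\<And>i. \<bar>y i - x i\<bar> < e" "\<And>i. i \<ge> m \<Longrightarrow> y i = 0"
    have "y i \<in> X i" for i
    proof (cases "X i = UNIV")
      case False
      then have "e \<le> d i" using X(3) by (simp add: e_def)
      then show ?thesis using d(2) y(1)[of i] by force
    qed simp
    then show "y \<in> U" using X(4) y(2) W(2) by auto
  qed
qed

text \<open>The preimage of a ball under \<open>h\<close> is open in \<open>U\<close>, hence in the
  coordinate space, and so contains a box around \<open>x\<close>.\<close>

lemma openin_Euclidean_space_continuous_box: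
  fixes h :: "(nat \<Rightarrow> real) \<Rightarrow> real"
  assumes U: "openin (Euclidean_space m) U" and x: "x \<in> U" and h: "continuous_on U h" and "\<epsilon> > 0"
  obtains e where "e > 0"
    "\<And>y. \<lbrakk>\<And>i. \<bar>y i - x i\<bar> < e; \<And>i. i \<ge> m \<Longrightarrow> y i = 0\<rbrakk> \<Longrightarrow> y \<in> U \<and> \<bar>h y - h x\<bar> < \<epsilon>"
proof -
  have "openin (top_of_set U) (U \<inter> h -` ball (h x) \<epsilon>)"
    by (rule continuous_openin_preimage_gen[OF h]) simp
  then have "openin (Euclidean_space m) (U \<inter> h -` ball (h x) \<epsilon>)"
    using U unfolding Euclidean_space_eq_top_of_set by (rule openin_trans)
  from openin_Euclidean_space_box[OF this, of x] x \<open>\<epsilon> > 0\<close> that show thesis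
    by (auto simp: dist_real_def abs_minus_commute)
qed

lemma eventually_coordinate_in_openin_Euclidean_space:
  assumes U: "openin (Euclidean_space m) U" and x: "x \<in> U" and i: "i < m"
  shows "\<forall>\<^sub>F t in nhds (x i). x(i := t) \<in> U"
proof -
  obtain e where e: "e > 0"
    "\<And>y. \<lbrakk>\<And>i. \<bar>y i - x i\<bar> < e; \<And>i. i \<ge> m \<Longrightarrow> y i = 0\<rbrakk> \<Longrightarrow> y \<in> U"
    using openin_Euclidean_space_box[OF U x] by blast
  have "x(i := t) \<in> U" if "dist t (x i) < e" for t
    using that e(1) i openin_Euclidean_space_imp_zero[OF U x]
    by (intro e(2)) (auto simp: dist_real_def)
  then show ?thesis using e(1) by (auto simp: eventually_nhds_metric)
qed

section \<open>Calculus of functions of class C^r\<close>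

lemma partial_deriv_eqI:
  assumes "((\<lambda>t. g (x(i := t))) has_vector_derivative D) (at (x i))"
  shows "partial_deriv i g x = D"
  using assms by (simp add: partial_deriv_def vector_derivative_at)

lemma Cr_on_has_vector_derivative:
  assumes "Cr_on (Suc r) m U g" "i < m" "x \<in> U"
  shows "((\<lambda>t. g (x(i := t))) has_vector_derivative partial_deriv i g x) (at (x i))"
  using assms by (simp add: partial_deriv_def vector_derivative_works)

lemma Cr_on_imp_continuous_on: "Cr_on r m U g \<Longrightarrow> continuous_on U g"
  by (cases r) auto

lemma has_vector_derivative_coordinate_cong:
  assumes U: "openin (Euclidean_space m) U" and i: "i < m" and x: "x \<in> U"
    and eq: "\<And>y. y \<in> U \<Longrightarrow> f y = g y"
  shows "((\<lambda>t. f (x(i := t))) has_vector_derivative D) (at (x i)) \<longleftrightarrow>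
    ((\<lambda>t. g (x(i := t))) has_vector_derivative D) (at (x i))"
proof (rule has_vector_derivative_cong_ev)
  show "\<forall>\<^sub>F t in nhds (x i). t \<in> UNIV \<longrightarrow> f (x(i := t)) = g (x(i := t))"
    using eventually_coordinate_in_openin_Euclidean_space[OF U x i]
    by eventually_elim (simp add: eq)
qed (simp add: eq x)

text \<open>Since \<open>U\<close> is open, a coordinate line through a point of \<open>U\<close>
  stays in \<open>U\<close> nearby. Values off \<open>U\<close> therefore do not affect the partial
  derivatives on \<open>U\<close>, and the induction passes to these.\<close>

lemma Cr_on_cong:
  assumes U: "openin (Euclidean_space m) U"
  shows "Cr_on r m U f \<Longrightarrow> (\<And>x. x \<in> U \<Longrightarrow> f x = g x) \<Longrightarrow> Cr_on r m U g"
proof (induction r arbitrary: f g)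
  case 0
  then show ?case using continuous_on_cong[of U U f g] by simp
next
  case (Suc r)
  have cont: "continuous_on U g"
    using Suc.prems continuous_on_cong[of U U f g] by simp
  have deriv: "((\<lambda>t. g (x(i := t))) has_vector_derivative partial_deriv i f x) (at (x i))"
    if "i < m" "x \<in> U" for i x
    using Cr_on_has_vector_derivative[OF Suc.prems(1) that]
      has_vector_derivative_coordinate_cong[OF U that, of f g] Suc.prems(2) by blast
  have "Cr_on r m U (partial_deriv i g)" if "i < m" for i
  proof (rule Suc.IH)
    show "Cr_on r m U (partial_deriv i f)" using Suc.prems(1) that by simp
    show "partial_deriv i f x = partial_deriv i g x" if "x \<in> U" for x
      using partial_deriv_eqI[OF deriv[OF \<open>i < m\<close> that]] by simp
  qed
  with cont deriv show ?case
    by (auto intro: differentiableI_vector)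
qed

text \<open>The introduction rule for the closure properties: any explicit formula \<open>G\<close>
  for the derivatives on \<open>U\<close> may stand in for \<open>partial_deriv\<close>.\<close>

lemma Cr_on_SucI:
  assumes U: "openin (Euclidean_space m) U" and cont: "continuous_on U g"
    and deriv: "\<And>i x. \<lbrakk>i < m; x \<in> U\<rbrakk> \<Longrightarrow>
      ((\<lambda>t. g (x(i := t))) has_vector_derivative G i x) (at (x i))"
    and G: "\<And>i. i < m \<Longrightarrow> Cr_on r m U (G i)"
  shows "Cr_on (Suc r) m U g"
proof -
  have "Cr_on r m U (partial_deriv i g)" if "i < m" for i
    by (rule Cr_on_cong[OF U G[OF that]]) (simp add: partial_deriv_eqI[OF deriv[OF that]])
  with cont deriv show ?thesis
    by (auto intro: differentiableI_vector)
qed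

lemma Cr_on_SucD: "Cr_on (Suc r) m U g \<Longrightarrow> Cr_on r m U g"
  by (induction r arbitrary: g) auto

lemma Cr_on_const:
  assumes U: "openin (Euclidean_space m) U"
  shows "Cr_on r m U (\<lambda>x. c)"
proof (induction r arbitrary: c)
  case (Suc r)
  then show ?case
    by (intro Cr_on_SucI[OF U, where G = "\<lambda>i x. 0"]) auto
qed simp

lemma Cr_on_add:
  assumes U: "openin (Euclidean_space m) U"
  shows "Cr_on r m U f \<Longrightarrow> Cr_on r m U g \<Longrightarrow> Cr_on r m U (\<lambda>x. f x + g x)"
proof (induction r arbitrary: f g)
  case 0
  then show ?case by (simp add: continuous_on_add)
next
  case (Suc r)
  show ?case
  proof (rule Cr_on_SucI[OF U, where G = "\<lambda>i x. partial_deriv i f x + partial_deriv i g x"])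
    show "continuous_on U (\<lambda>x. f x + g x)"
      using Suc.prems by (simp add: continuous_on_add)
    show "Cr_on r m U (\<lambda>x. partial_deriv i f x + partial_deriv i g x)" if "i < m" for i
      using Suc that by simp
  qed (intro has_vector_derivative_add Cr_on_has_vector_derivative[OF Suc.prems(1)]
         Cr_on_has_vector_derivative[OF Suc.prems(2)])
qed

lemma Cr_on_mult:
  fixes f g :: "(nat \<Rightarrow> real) \<Rightarrow> 'b::real_normed_algebra"
  assumes U: "openin (Euclidean_space m) U"
  shows "Cr_on r m U f \<Longrightarrow> Cr_on r m U g \<Longrightarrow> Cr_on r m U (\<lambda>x. f x * g x)"
proof (induction r arbitrary: f g)
  case 0
  then show ?case by (simp add: continuous_on_mult)
next
  case (Suc r)
  show ?case
  proof (rule Cr_on_SucI[OF U, where G = "\<lambda>i x. f x * partial_deriv i g x + partial_deriv i f x * g x"])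
    show "continuous_on U (\<lambda>x. f x * g x)"
      using Suc.prems by (simp add: continuous_on_mult)
    show "Cr_on r m U (\<lambda>x. f x * partial_deriv i g x + partial_deriv i f x * g x)" if "i < m" for i
      \<comment> \<open>The product rule also contains the undifferentiated factors, whose order
        \<open>Cr_on_SucD\<close> lowers to \<open>r\<close> for the induction hypothesis.\<close>
      using Suc.prems[THEN Cr_on_SucD] Suc.prems that
      by (intro Cr_on_add[OF U] Suc.IH) simp_all
    show "((\<lambda>t. f (x(i := t)) * g (x(i := t))) has_vector_derivative
        f x * partial_deriv i g x + partial_deriv i f x * g x) (at (x i))" if "i < m" "x \<in> U" for i x
      using has_vector_derivative_mult[OF Cr_on_has_vector_derivative[OF Suc.prems(1) that]
          Cr_on_has_vector_derivative[OF Suc.prems(2) that]] by (simp only: fun_upd_triv)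
  qed
qed

lemma Cr_on_bounded_linear:
  assumes U: "openin (Euclidean_space m) U" and L: "bounded_linear L"
  shows "Cr_on r m U g \<Longrightarrow> Cr_on r m U (\<lambda>x. L (g x))"
proof (induction r arbitrary: g)
  case 0
  then show ?case by (simp add: bounded_linear.continuous_on[OF L])
next
  case (Suc r)
  show ?case
  proof (rule Cr_on_SucI[OF U, where G = "\<lambda>i x. L (partial_deriv i g x)"])
    show "continuous_on U (\<lambda>x. L (g x))"
      using Suc.prems by (simp add: bounded_linear.continuous_on[OF L])
    show "Cr_on r m U (\<lambda>x. L (partial_deriv i g x))" if "i < m" for i
      using Suc that by simp
  qed (intro bounded_linear.has_vector_derivative[OF L] Cr_on_has_vector_derivative[OF Suc.prems])
qed

text \<open>Polynomials arise from bounded linear maps and constants by sums and products, so the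
  closure rules above suffice. This makes the polynomial of a tensor smooth in every chart.\<close>

lemma Cr_on_real_polynomial_function:
  assumes U: "openin (Euclidean_space m) U" and g: "Cr_on r m U g"
  shows "real_polynomial_function p \<Longrightarrow> Cr_on r m U (\<lambda>x. p (g x))"
proof (induction p rule: real_polynomial_function.induct)
  case (linear f)
  then show ?case using Cr_on_bounded_linear[OF U] g by blast
qed (auto intro: Cr_on_const[OF U] Cr_on_add[OF U] Cr_on_mult[OF U])

section \<open>Mean value theorems and symmetry of second partial derivatives\<close>

text \<open>The one-variable mean value theorem on a coordinate segment. The step \<open>s\<close>
  may have either sign or vanish, hence the weak bound on \<open>z\<close>.\<close>

lemma partial_deriv_MVT:
  fixes g :: "(nat \<Rightarrow> real) \<Rightarrow> real"
  assumes g: "Cr_on (Suc r) m U g" and i: "i < m"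
    and seg: "\<And>t. \<bar>t\<bar> \<le> \<bar>s\<bar> \<Longrightarrow> y(i := y i + t) \<in> U"
  obtains z where "\<bar>z\<bar> \<le> \<bar>s\<bar>" "g (y(i := y i + s)) - g y = s * partial_deriv i g (y(i := y i + z))"
proof -
  have der: "((\<lambda>t. g (y(i := y i + t))) has_real_derivative partial_deriv i g (y(i := y i + t))) (at t)"
    if "\<bar>t\<bar> \<le> \<bar>s\<bar>" for t
    using Cr_on_has_vector_derivative[OF g i seg[OF that]] DERIV_shift[of "\<lambda>u. g (y(i := u))" _ t "y i"]
    by (simp add: has_real_derivative_iff_has_vector_derivative add.commute)
  consider "s = 0" | "s > 0" | "s < 0" by linarith
  then show thesis
  proof cases
    case 1
    then show ?thesis using that[of 0] by simp
  next
    case 2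
    obtain z where "0 < z" "z < s" "g (y(i := y i + s)) - g (y(i := y i + 0)) = (s - 0) * partial_deriv i g (y(i := y i + z))"
      using MVT2[OF 2 der] by auto
    then show ?thesis using that[of z] by simp
  next
    case 3
    obtain z where "s < z" "z < 0" "g (y(i := y i + 0)) - g (y(i := y i + s)) = (0 - s) * partial_deriv i g (y(i := y i + z))"
      using MVT2[OF 3 der] by auto
    then show ?thesis using that[of z] by simp
  qed
qed

text \<open>The second difference is an increment in direction \<open>i\<close> of an increment in
  direction \<open>j\<close>. The mean value theorem is applied first in direction \<open>i\<close>,
  then to \<open>partial_deriv i g\<close> in direction \<open>j\<close>.\<close>

lemma second_difference_MVT:
  fixes g :: "(nat \<Rightarrow> real) \<Rightarrow> real"
  assumes g: "Cr_on (Suc (Suc r)) m U g" and ij: "i < m" "j < m" "i \<noteq> j" and t: "t > 0"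
    and box: "\<And>a b. \<lbrakk>\<bar>a\<bar> \<le> t; \<bar>b\<bar> \<le> t\<rbrakk> \<Longrightarrow> x(i := x i + a, j := x j + b) \<in> U"
  obtains a b where "\<bar>a\<bar> \<le> t" "\<bar>b\<bar> \<le> t"
    "g (x(i := x i + t, j := x j + t)) - g (x(i := x i + t)) - g (x(j := x j + t)) + g x =
     t\<^sup>2 * partial_deriv j (partial_deriv i g) (x(i := x i + a, j := x j + b))"
proof -
  have der: "((\<lambda>a. g (x(i := x i + a, j := x j + b))) has_real_derivative
      partial_deriv i g (x(i := x i + a, j := x j + b))) (at a)" if "\<bar>a\<bar> \<le> t" "\<bar>b\<bar> \<le> t" for a b
  proof -
    have "(x(i := x i + a, j := x j + b))(i := u) = x(i := u, j := x j + b)" for u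
      using ij by (auto simp: fun_eq_iff)
    then show ?thesis
      using Cr_on_has_vector_derivative[OF g ij(1) box[OF that]] ij(3)
        DERIV_shift[of "\<lambda>u. g (x(i := u, j := x j + b))" _ a "x i"]
      by (simp add: has_real_derivative_iff_has_vector_derivative add.commute)
  qed
  \<comment> \<open>\<open>u a\<close> is the increment in direction \<open>j\<close> after a shift
    by \<open>a\<close> in direction \<open>i\<close>; writing \<open>x j + 0\<close> makes both
    terms instances of \<open>der\<close>.\<close>
  define u where "u a = g (x(i := x i + a, j := x j + t)) - g (x(i := x i + a, j := x j + 0))" for a
  have "\<exists>a. 0 < a \<and> a < t \<and> u t - u 0 = (t - 0) *
      (partial_deriv i g (x(i := x i + a, j := x j + t)) - partial_deriv i g (x(i := x i + a, j := x j + 0)))"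
    unfolding u_def using t by (intro MVT2 DERIV_diff der) auto
  then obtain a where a: "0 < a" "a < t" "u t - u 0 = t *
      (partial_deriv i g (x(i := x i + a, j := x j + t)) - partial_deriv i g (x(i := x i + a, j := x j + 0)))"
    by auto
  have g': "Cr_on (Suc r) m U (partial_deriv i g)" using g ij by simp
  obtain b where b: "\<bar>b\<bar> \<le> \<bar>t\<bar>"
    "partial_deriv i g ((x(i := x i + a))(j := (x(i := x i + a)) j + t)) - partial_deriv i g (x(i := x i + a)) =
     t * partial_deriv j (partial_deriv i g) ((x(i := x i + a))(j := (x(i := x i + a)) j + b))"
    by (rule partial_deriv_MVT[OF g' ij(2), of t "x(i := x i + a)"]) (use box a ij t in auto)
  have upd: "x(i := x i + a, j := x j) = x(i := x i + a)" for a
    using ij by (auto simp: fun_eq_iff)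
  with a(3) b(2) ij have "u t - u 0 = t\<^sup>2 * partial_deriv j (partial_deriv i g) (x(i := x i + a, j := x j + b))"
    by (simp add: power2_eq_square)
  moreover have "u t - u 0 =
      g (x(i := x i + t, j := x j + t)) - g (x(i := x i + t)) - g (x(j := x j + t)) + g x"
    using upd by (simp add: u_def)
  ultimately show thesis using that[of a b] a b t by simp
qed

text \<open>Schwarz's theorem: the same second difference equals \<open>t\<^sup>2\<close> times
  either mixed derivative at some point near \<open>x\<close>, and both mixed derivatives are
  continuous at \<open>x\<close>.\<close>

lemma partial_deriv_commute:
  fixes g :: "(nat \<Rightarrow> real) \<Rightarrow> real"
  assumes U: "openin (Euclidean_space m) U" and g: "Cr_on (Suc (Suc r)) m U g"
    and ij: "i < m" "j < m" and x: "x \<in> U"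
  shows "partial_deriv i (partial_deriv j g) x = partial_deriv j (partial_deriv i g) x"
proof (cases "i = j")
  case False
  let ?A = "partial_deriv j (partial_deriv i g)" and ?B = "partial_deriv i (partial_deriv j g)"
  have cont: "continuous_on U ?A" "continuous_on U ?B"
    using g ij by (auto dest: Cr_on_imp_continuous_on)
  have "\<bar>?B x - ?A x\<bar> \<le> \<epsilon>" if "\<epsilon> > 0" for \<epsilon>
  proof -
    have "\<epsilon> / 2 > 0" using that by simp
    note box = openin_Euclidean_space_continuous_box[OF U x _ this]
    obtain d where d: "d > 0"
      "\<And>y. \<lbrakk>\<And>k. \<bar>y k - x k\<bar> < d; \<And>k. k \<ge> m \<Longrightarrow> y k = 0\<rbrakk> \<Longrightarrow> y \<in> U \<and> \<bar>?A y - ?A x\<bar> < \<epsilon> / 2"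
      using box[OF cont(1)] by blast
    obtain e where e: "e > 0"
      "\<And>y. \<lbrakk>\<And>k. \<bar>y k - x k\<bar> < e; \<And>k. k \<ge> m \<Longrightarrow> y k = 0\<rbrakk> \<Longrightarrow> y \<in> U \<and> \<bar>?B y - ?B x\<bar> < \<epsilon> / 2"
      using box[OF cont(2)] by blast
    \<comment> \<open>Half the smaller radius, so that every displaced point lies in both
      boxes.\<close>
    define t where "t = min d e / 2"
    have t: "t > 0" "t < d" "t < e" using d(1) e(1) by (auto simp: t_def)
    have A: "x(i := x i + a, j := x j + b) \<in> U \<and> \<bar>?A (x(i := x i + a, j := x j + b)) - ?A x\<bar> < \<epsilon> / 2"
      if "\<bar>a\<bar> \<le> t" "\<bar>b\<bar> \<le> t" for a b
      using that t ij openin_Euclidean_space_imp_zero[OF U x] by (intro d(2)) auto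
    have B: "x(j := x j + a, i := x i + b) \<in> U \<and> \<bar>?B (x(j := x j + a, i := x i + b)) - ?B x\<bar> < \<epsilon> / 2"
      if "\<bar>a\<bar> \<le> t" "\<bar>b\<bar> \<le> t" for a b
      using that t ij openin_Euclidean_space_imp_zero[OF U x] by (intro e(2)) auto
    obtain a b where ab: "\<bar>a\<bar> \<le> t" "\<bar>b\<bar> \<le> t"
      "g (x(i := x i + t, j := x j + t)) - g (x(i := x i + t)) - g (x(j := x j + t)) + g x =
       t\<^sup>2 * ?A (x(i := x i + a, j := x j + b))"
      using second_difference_MVT[OF g ij False t(1), of x] A by blast
    obtain a' b' where ab': "\<bar>a'\<bar> \<le> t" "\<bar>b'\<bar> \<le> t"
      "g (x(j := x j + t, i := x i + t)) - g (x(j := x j + t)) - g (x(i := x i + t)) + g x =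
       t\<^sup>2 * ?B (x(j := x j + a', i := x i + b'))"
      using second_difference_MVT[OF g ij(2,1) False[symmetric] t(1), of x] B by blast
    \<comment> \<open>Updates at distinct indices commute, so the two second differences
      coincide.\<close>
    have "x(i := x i + t, j := x j + t) = x(j := x j + t, i := x i + t)"
      using False by (simp add: fun_upd_twist)
    with ab(3) ab'(3) t(1) have "?A (x(i := x i + a, j := x j + b)) = ?B (x(j := x j + a', i := x i + b'))"
      by (simp add: algebra_simps)
    then show ?thesis using A[OF ab(1,2)] B[OF ab'(1,2)] by linarith
  qed
  then show ?thesis using field_le_epsilon[of "\<bar>?B x - ?A x\<bar>" 0] by fastforce
qed simp

section \<open>Differentiation along straight lines\<close>

text \<open>The bound is one plus the sum of absolute values; the one keeps it positive, so that it
  can serve as a divisor.\<close>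

lemma finite_support_bounded:
  fixes c :: "nat \<Rightarrow> real"
  assumes "\<And>i. i \<ge> m \<Longrightarrow> c i = 0"
  obtains M where "M > 0" "\<And>i. \<bar>c i\<bar> \<le> M"
proof
  show "1 + (\<Sum>i<m. \<bar>c i\<bar>) > 0" by (simp add: add_pos_nonneg sum_nonneg)
  show "\<bar>c i\<bar> \<le> 1 + (\<Sum>i<m. \<bar>c i\<bar>)" for i
  proof (cases "i < m")
    case True
    then have "\<bar>c i\<bar> \<le> (\<Sum>i<m. \<bar>c i\<bar>)" by (intro member_le_sum) auto
    then show ?thesis by simp
  qed (simp add: assms sum_nonneg add_nonneg_nonneg)
qed

text \<open>The increment along the line telescopes into increments in single coordinates. Each is
  evaluated by the mean value theorem, and continuity of the partial derivatives gives the
  limit.\<close>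

lemma has_real_derivative_along_line:
  fixes g :: "(nat \<Rightarrow> real) \<Rightarrow> real"
  assumes U: "openin (Euclidean_space m) U" and g: "Cr_on (Suc r) m U g"
    and c: "\<And>i. i \<ge> m \<Longrightarrow> c i = 0" and x: "(\<lambda>i. x i + s * c i) \<in> U"
  shows "((\<lambda>t. g (\<lambda>i. x i + t * c i)) has_real_derivative
    (\<Sum>i<m. c i * partial_deriv i g (\<lambda>i. x i + s * c i))) (at s)"
proof -
  define y where "y = (\<lambda>i. x i + s * c i)"
  have y: "y \<in> U" using x by (simp add: y_def)
  note y0 = openin_Euclidean_space_imp_zero[OF U y]
  \<comment> \<open>\<open>P p h\<close> moves only the first \<open>p\<close> coordinates, so that consecutive points differ in a single one.\<close>
  define P where "P p h = (\<lambda>i. if i < p then y i + h * c i else y i)" for p h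
  have P_Suc: "P (Suc p) h = (P p h)(p := P p h p + h * c p)" for p h
    by (auto simp: P_def fun_eq_iff)
  obtain M where M: "M > 0" and cM: "\<And>i. \<bar>c i\<bar> \<le> M"
    using finite_support_bounded[of m c] c by blast
  have step: "((\<lambda>h. (g (P (Suc p) h) - g (P p h)) / h) \<longlongrightarrow> c p * partial_deriv p g y) (at 0)"
    if p: "p < m" for p
  proof (rule tendstoI)
    fix \<epsilon> :: real assume "\<epsilon> > 0"
    \<comment> \<open>The error in the partial derivative is later multiplied by \<open>c p\<close>,
      of size at most \<open>M\<close>.\<close>
    then have "\<epsilon> / M > 0" using M by simp
    moreover have "continuous_on U (partial_deriv p g)"
      using g p by (auto dest: Cr_on_imp_continuous_on)
    ultimately obtain e where e: "e > 0"
      "\<And>z. \<lbrakk>\<And>k. \<bar>z k - y k\<bar> < e; \<And>k. k \<ge> m \<Longrightarrow> z k = 0\<rbrakk> \<Longrightarrow>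
        z \<in> U \<and> \<bar>partial_deriv p g z - partial_deriv p g y\<bar> < \<epsilon> / M"
      using openin_Euclidean_space_continuous_box[OF U y] by blast
    have "dist ((g (P (Suc p) h) - g (P p h)) / h) (c p * partial_deriv p g y) < \<epsilon>"
      if h: "h \<noteq> 0" "dist h 0 < e / M" for h
    proof -
      have hM: "\<bar>h\<bar> * M < e" using h M by (simp add: field_simps)
      have hc: "\<bar>h * c i\<bar> < e" for i
        using mult_left_mono[OF cM[of i], of "\<bar>h\<bar>"] hM by (simp add: abs_mult)
      have near: "(P p h)(p := P p h p + t) \<in> U \<and>
          \<bar>partial_deriv p g ((P p h)(p := P p h p + t)) - partial_deriv p g y\<bar> < \<epsilon> / M"
        if "\<bar>t\<bar> \<le> \<bar>h * c p\<bar>" for t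
      proof -
        have "\<bar>t\<bar> < e" using that hc[of p] by linarith
        then show ?thesis using hc e(1) p y0 by (intro e(2)) (auto simp: P_def)
      qed
      obtain z where z: "\<bar>z\<bar> \<le> \<bar>h * c p\<bar>"
        "g (P (Suc p) h) - g (P p h) = h * c p * partial_deriv p g ((P p h)(p := P p h p + z))"
        unfolding P_Suc using partial_deriv_MVT[OF g p] near by metis
      let ?d = "partial_deriv p g ((P p h)(p := P p h p + z)) - partial_deriv p g y"
      have "(g (P (Suc p) h) - g (P p h)) / h - c p * partial_deriv p g y = c p * ?d"
        using z(2) h(1) by (simp add: algebra_simps)
      moreover have "\<bar>c p\<bar> * \<bar>?d\<bar> < \<epsilon>"
      proof -
        have "\<bar>c p\<bar> * \<bar>?d\<bar> \<le> M * \<bar>?d\<bar>" by (rule mult_right_mono[OF cM]) simp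
        also have "\<dots> < \<epsilon>" using near[OF z(1)] M by (simp add: field_simps)
        finally show ?thesis .
      qed
      ultimately show ?thesis by (simp add: dist_real_def abs_mult)
    qed
    then show "\<forall>\<^sub>F h in at 0. dist ((g (P (Suc p) h) - g (P p h)) / h) (c p * partial_deriv p g y) < \<epsilon>"
      unfolding eventually_at using e(1) M by (intro exI[of _ "e / M"]) auto
  qed
  \<comment> \<open>Adding up the limits of the single-coordinate quotients, by induction on the
    number of coordinates moved.\<close>
  have lim: "((\<lambda>h. (g (P p h) - g y) / h) \<longlongrightarrow> (\<Sum>i<p. c i * partial_deriv i g y)) (at 0)"
    if "p \<le> m" for p
    using that
  proof (induction p)
    case 0
    then show ?case by (simp add: P_def)
  next
    case (Suc p)
    from tendsto_add[OF Suc.IH step, of p] Suc.prems show ?case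
      by (simp add: diff_divide_distrib)
  qed
  \<comment> \<open>As \<open>c\<close> vanishes from index \<open>m\<close> on, moving the first
    \<open>m\<close> coordinates already gives the point of the line at parameter
    \<open>s + h\<close>.\<close>
  have "P m h = (\<lambda>i. x i + (s + h) * c i)" for h
    using c by (auto simp: P_def y_def fun_eq_iff algebra_simps)
  with lim[of m] show ?thesis
    by (simp add: DERIV_def y_def)
qed

section \<open>First- and second-order conditions at a maximum\<close>

lemma partial_deriv_eq_0_at_max:
  fixes g :: "(nat \<Rightarrow> real) \<Rightarrow> real"
  assumes U: "openin (Euclidean_space m) U" and g: "Cr_on (Suc r) m U g"
    and x: "x \<in> U" and max: "\<And>y. y \<in> U \<Longrightarrow> g y \<le> g x" and i: "i < m"
  shows "partial_deriv i g x = 0"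
proof -
  have "((\<lambda>t. g (x(i := t))) has_real_derivative partial_deriv i g x) (at (x i))"
    using Cr_on_has_vector_derivative[OF g i x]
    by (simp add: has_real_derivative_iff_has_vector_derivative)
  moreover obtain d where "d > 0" "\<And>t. dist t (x i) < d \<Longrightarrow> x(i := t) \<in> U"
    using eventually_coordinate_in_openin_Euclidean_space[OF U x i]
    unfolding eventually_nhds_metric by blast
  ultimately show ?thesis
    using max
    by (intro DERIV_local_max[of "\<lambda>t. g (x(i := t))" _ "x i" d])
      (auto simp: dist_real_def abs_minus_commute)
qed

text \<open>At the maximum \<open>D 0 = 0\<close>. If \<open>S\<close> were positive,
  \<open>D\<close> would be positive just to the right of 0, and by the mean value theorem
  \<open>h\<close> would exceed \<open>h 0\<close> there.\<close>

lemma second_derivative_le_0_at_max: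
  fixes h :: "real \<Rightarrow> real"
  assumes d: "d > 0" and h: "\<And>t. \<bar>t\<bar> < d \<Longrightarrow> (h has_real_derivative D t) (at t)"
    and D: "(D has_real_derivative S) (at 0)" and max: "\<And>t. \<bar>t\<bar> < d \<Longrightarrow> h t \<le> h 0"
  shows "S \<le> 0"
proof (rule ccontr)
  assume "\<not> S \<le> 0"
  then obtain e where e: "e > 0" "\<And>t. \<lbrakk>0 < t; t < e\<rbrakk> \<Longrightarrow> D 0 < D t"
    using DERIV_pos_inc_right[OF D] by auto
  have D0: "D 0 = 0"
    using h[of 0] d max by (intro DERIV_local_max[of h "D 0" 0 d]) auto
  define t where "t = min d e / 2"
  have t: "0 < t" "t < d" "t < e" using d e(1) by (auto simp: t_def)
  obtain z where "0 < z" "z < t" "h t - h 0 = (t - 0) * D z"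
    using MVT2[OF t(1), of h D] h t by auto
  then have "h t > h 0" using e(2)[of z] D0 t by (simp add: algebra_simps)
  then show False using max[of t] t by simp
qed

text \<open>The quadratic form of the Hessian at \<open>c\<close> is the second derivative of
  \<open>g\<close> along the line through \<open>x\<close> in direction \<open>c\<close>.\<close>

lemma hessian_le_0_at_max:
  fixes g :: "(nat \<Rightarrow> real) \<Rightarrow> real"
  assumes U: "openin (Euclidean_space m) U" and g: "Cr_on (Suc (Suc r)) m U g"
    and x: "x \<in> U" and max: "\<And>y. y \<in> U \<Longrightarrow> g y \<le> g x"
  shows "(\<Sum>j<m. \<Sum>i<m. c j * c i * partial_deriv i (partial_deriv j g) x) \<le> 0"
proof -
  \<comment> \<open>Truncating \<open>c\<close> keeps the line inside the coordinate space, and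
    hence near \<open>x\<close> inside \<open>U\<close>.\<close>
  define c' where "c' i = (if i < m then c i else 0)" for i
  have c': "c' i = 0" if "i \<ge> m" for i using that by (simp add: c'_def)
  obtain e where e: "e > 0"
    "\<And>y. \<lbrakk>\<And>i. \<bar>y i - x i\<bar> < e; \<And>i. i \<ge> m \<Longrightarrow> y i = 0\<rbrakk> \<Longrightarrow> y \<in> U"
    using openin_Euclidean_space_box[OF U x] by blast
  obtain M where M: "M > 0" and cM: "\<And>i. \<bar>c' i\<bar> \<le> M"
    using finite_support_bounded[of m c'] c' by blast
  have inU: "(\<lambda>i. x i + t * c' i) \<in> U" if t: "\<bar>t\<bar> < e / M" for t
  proof (rule e(2))
    fix i
    have "\<bar>t\<bar> * \<bar>c' i\<bar> \<le> \<bar>t\<bar> * M" by (rule mult_left_mono[OF cM]) simp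
    also have "\<dots> < e" using t M by (simp add: field_simps)
    finally show "\<bar>x i + t * c' i - x i\<bar> < e" by (simp add: abs_mult)
  qed (simp add: c' openin_Euclidean_space_imp_zero[OF U x])
  have g': "Cr_on (Suc r) m U (partial_deriv j g)" if "j < m" for j
    using g that by simp
  have "(\<Sum>j<m. c' j * (\<Sum>i<m. c' i * partial_deriv i (partial_deriv j g) x)) \<le> 0"
  proof (rule second_derivative_le_0_at_max)
    show "e / M > 0" using e(1) M by simp
    show "((\<lambda>t. g (\<lambda>i. x i + t * c' i)) has_real_derivative
        (\<Sum>j<m. c' j * partial_deriv j g (\<lambda>i. x i + t * c' i))) (at t)" if "\<bar>t\<bar> < e / M" for t
      by (rule has_real_derivative_along_line[OF U g c' inU[OF that]])
    show "((\<lambda>t. \<Sum>j<m. c' j * partial_deriv j g (\<lambda>i. x i + t * c' i)) has_real_derivative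
        (\<Sum>j<m. c' j * (\<Sum>i<m. c' i * partial_deriv i (partial_deriv j g) x))) (at 0)"
    proof (intro DERIV_sum DERIV_cmult)
      fix j assume "j \<in> {..<m}"
      then show "((\<lambda>t. partial_deriv j g (\<lambda>i. x i + t * c' i)) has_real_derivative
          (\<Sum>i<m. c' i * partial_deriv i (partial_deriv j g) x)) (at 0)"
        using has_real_derivative_along_line[OF U g' c', where s = 0 and x = x] x by simp
    qed
  qed (use max inU in simp)
  also have "(\<Sum>j<m. c' j * (\<Sum>i<m. c' i * partial_deriv i (partial_deriv j g) x)) =
      (\<Sum>j<m. \<Sum>i<m. c j * c i * partial_deriv i (partial_deriv j g) x)"
    by (simp add: c'_def sum_distrib_left mult.assoc)
  finally show ?thesis .
qed

section \<open>Polynomiality of the form of a tensor\<close>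

text \<open>Induction on the number \<open>p\<close> of slots that hold the variable
  \<open>v\<close>, the others being frozen at an arbitrary \<open>w\<close>. Linearity in a new
  slot expands \<open>v\<close> in the basis.\<close>

lemma real_polynomial_function_tensor_poly:
  fixes T :: "(nat \<Rightarrow> 'a::euclidean_space) \<Rightarrow> real"
  assumes T: "symmetric_tensor k T"
  shows "real_polynomial_function (tensor_poly T)"
proof -
  have lin: "linear (\<lambda>x. T (v(i := x)))" if "i < k" for v i
    by (rule T[unfolded symmetric_tensor_def, THEN conjunct2, THEN conjunct1, rule_format, OF that])
  have "real_polynomial_function (\<lambda>v. T (\<lambda>i. if i < p then v else w i))" if "p \<le> k" for p w
    using that
  proof (induction p arbitrary: w)
    case 0
    then show ?case by auto
  next
    case (Suc p)
    have "T (\<lambda>i. if i < Suc p then v else w i) =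
        (\<Sum>b\<in>Basis. inner v b * T (\<lambda>i. if i < p then v else (w(p := b)) i))" for v
    proof -
      define u where "u = (\<lambda>i. if i < p then v else w i)"
      interpret L: linear "\<lambda>x. T (u(p := x))" using lin Suc.prems by simp
      have upd: "u(p := b) = (\<lambda>i. if i < p then v else (w(p := b)) i)" for b
        by (auto simp: u_def)
      have "(\<lambda>i. if i < Suc p then v else w i) = u(p := \<Sum>b\<in>Basis. inner v b *\<^sub>R b)"
        unfolding euclidean_representation by (auto simp: u_def)
      then have "T (\<lambda>i. if i < Suc p then v else w i) = T (u(p := \<Sum>b\<in>Basis. inner v b *\<^sub>R b))"
        by (simp only:)
      also have "\<dots> = (\<Sum>b\<in>Basis. inner v b * T (u(p := b)))"
        unfolding L.sum L.scale by simp
      finally show ?thesis by (simp only: upd)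
    qed
    moreover have "real_polynomial_function
        (\<lambda>v. \<Sum>b\<in>Basis. inner v b * T (\<lambda>i. if i < p then v else (w(p := b)) i))"
      using Suc.IH Suc.prems
      by (intro real_polynomial_function_sum real_polynomial_function.intros(4)
          real_polynomial_function.intros(1)[OF bounded_linear_inner_left]) auto
    ultimately show ?case by simp
  qed
  \<comment> \<open>The entries from index \<open>k\<close> on are set to 0; the value of
    \<open>T\<close> depends only on the first \<open>k\<close>.\<close>
  from this[where p = k and w = "\<lambda>_. 0"]
  have "real_polynomial_function (\<lambda>v. T (\<lambda>i. if i < k then v else 0))" by simp
  moreover have "T (\<lambda>i. if i < k then v else 0) = tensor_poly T v" for v
    unfolding tensor_poly_def
    by (rule T[unfolded symmetric_tensor_def, THEN conjunct1, rule_format]) simp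
  ultimately show ?thesis by simp
qed


section \<open>The maximum on the sphere as an eigenvector of top index\<close>

theorem theorem5p3:
  fixes T :: "(nat \<Rightarrow> 'a::euclidean_space) \<Rightarrow> real" and k :: nat
  assumes "k \<ge> 1"
    and "symmetric_tensor k T"
    and "nondegenerate_tensor T"
  shows "\<exists>v. unit_eigenvector T v \<and> sphere_has_morse_index (tensor_poly T) v (DIM('a) - 1)"
proof -
  let ?f = "tensor_poly T" and ?m = "DIM('a) - 1"
  have poly: "real_polynomial_function ?f"
    by (rule real_polynomial_function_tensor_poly[OF assms(2)])
  have "continuous_on (sphere 0 1) ?f"
    using poly by (simp add: continuous_on_polymonial_function real_polynomial_function_eq)
  then obtain v where v: "v \<in> sphere 0 1" "\<And>w. w \<in> sphere 0 1 \<Longrightarrow> ?f w \<le> ?f v"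
    using continuous_attains_sup[of "sphere 0 1" ?f] by auto
  have smooth: "Cr_on r ?m U (?f \<circ> \<phi>)" if "sphere_param U \<phi>" for r U and \<phi> :: "_ \<Rightarrow> 'a"
    using Cr_on_real_polynomial_function[OF _ _ poly] that
    by (auto simp: sphere_param_def smooth_on_coords_def comp_def)
  \<comment> \<open>The image of a chart lies in the sphere, so the global maximum \<open>v\<close>
    is a maximum over all of \<open>U\<close> in every chart.\<close>
  have max: "(?f \<circ> \<phi>) y \<le> (?f \<circ> \<phi>) x"
    if "sphere_param U \<phi>" "\<phi> x = v" "y \<in> U" for U x y and \<phi> :: "_ \<Rightarrow> 'a"
  proof -
    have "\<phi> ` U \<subseteq> sphere 0 1"
      using that(1) openin_subset[of "top_of_set (sphere 0 1)" "\<phi> ` U"] by (simp add: sphere_param_def)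
    then show ?thesis using v(2) that by auto
  qed
  have crit: "sphere_critical_point ?f v"
    unfolding sphere_critical_point_def
  proof (intro conjI allI impI; (elim conjE)?)
    fix U x i and \<phi> :: "_ \<Rightarrow> 'a"
    assume \<phi>: "sphere_param U \<phi>" "x \<in> U" "\<phi> x = v" and i: "i < ?m"
    from \<phi>(1) have U: "openin (Euclidean_space ?m) U" by (simp add: sphere_param_def)
    show "partial_deriv i (?f \<circ> \<phi>) x = 0"
      by (rule partial_deriv_eq_0_at_max[OF U smooth[OF \<phi>(1)] \<phi>(2) max[OF \<phi>(1,3)] i])
  qed (rule v(1))
  then have nondeg: "sphere_nondegenerate_critical_point ?f v"
    using assms(3) by (simp add: nondegenerate_tensor_def unit_eigenvector_def)
  have "num_neg_eigenvalues (hessian_mat ?m (?f \<circ> \<phi>) x) = ?m"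
    if \<phi>: "sphere_param U \<phi>" "x \<in> U" "\<phi> x = v" for U x and \<phi> :: "_ \<Rightarrow> 'a"
  proof (rule num_neg_eigenvalues_negative_definite)
    let ?H = "hessian_mat ?m (?f \<circ> \<phi>) x"
    from \<phi>(1) have U: "openin (Euclidean_space ?m) U" by (simp add: sphere_param_def)
    show "?H \<in> carrier_mat ?m ?m" by (simp add: hessian_mat_def)
    show "transpose_mat ?H = ?H"
      using partial_deriv_commute[OF U smooth[OF \<phi>(1)] _ _ \<phi>(2)]
      by (intro eq_matI) (auto simp: hessian_mat_def)
    show "invertible_mat ?H"
      using nondeg \<phi> unfolding sphere_nondegenerate_critical_point_def by blast
    fix w :: "real vec" assume w: "w \<in> carrier_vec ?m"
    have "scalar_prod w (?H *\<^sub>v w) = (\<Sum>i<?m. \<Sum>j<?m.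
        vec_index w j * vec_index w i * partial_deriv i (partial_deriv j (?f \<circ> \<phi>)) x)"
      using w by (simp add: hessian_mat_def scalar_prod_def sum_distrib_left mult_ac lessThan_atLeast0)
    \<comment> \<open>The sums are exchanged to match the order of summation in
      \<open>hessian_le_0_at_max\<close>.\<close>
    also have "\<dots> = (\<Sum>j<?m. \<Sum>i<?m.
        vec_index w j * vec_index w i * partial_deriv i (partial_deriv j (?f \<circ> \<phi>)) x)"
      by (rule sum.swap)
    also have "\<dots> \<le> 0"
      by (rule hessian_le_0_at_max[OF U smooth[OF \<phi>(1)] \<phi>(2) max[OF \<phi>(1,3)]])
    finally show "scalar_prod w (?H *\<^sub>v w) \<le> 0" .
  qed
  then have "sphere_has_morse_index ?f v ?m"
    unfolding sphere_has_morse_index_def using nondeg by blast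
  with crit show ?thesis by (auto simp: unit_eigenvector_def)
qed

end
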